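(* Let $\varrho$ be an aperiodic, primitive, bijective substitution of constant length $L$ with $\varrho_0=\mathrm{id}$. Suppose further that (1) the group $G$ generated by the columns of $\varrho$ is Abelian, and (2) $\varrho$ is $g$-palindromic for some $g\in G$. Then any fixed point $w$ of $\varrho$ satisfies, for every $n\geqslant 1$ and every even $\ell\geqslant 2$, $$L^{n}\leqslant A_w\left(\frac{L^{n\ell}-1}{L^n+1}\right)<\infty .$$
   Context: $\mathbb{N}=\mathbb{Z}_{\geqslant 0}$. A substitution on a finite alphabet $\mathcal{A}$ is a map $\varrho\colon\mathcal{A}\to\mathcal{A}^+$, extended to words by concatenation. It has constant length $L$ if $|\varrho(a)|=L$ for all $a$; its $i$-th column ($0\leqslant i\leqslant L-1$) is the map $\varrho_i\colon\mathcal{A}\to\mathcal{A}$ sending $a$ to the $i$-th letter of $\varrho(a)$ (indices from $0$). It is bijective if every column is a bijection. It is primitive if some power $\varrho^n$ is such that every $\varrho^n(a)$ contains all letters. A fixed point is $w\in\mathcal{A}^{\mathbb{N}}$ with $\varrho(w)=w$; $\varrho$ is aperiodic if it has no fixed point of the form $v^\infty$ with $v$ a finite word. $G$ is the subgroup of the symmetric group on $\mathcal{A}$ generated by $\varrho_0,\dots,\varrho_{L-1}$. $\varrho$ is $g$-palindromic, for $g\in G$, if $\varrho_i\cdot\varrho_{L-1-i}=g$ (composition in $G$) for all $0\leqslant i\leqslant L-1$. For $w\in\mathcal{A}^{\mathbb{N}}$ and $d\geqslant1$, $A_w(d)$ is the maximum (supremum, in $\mathbb{N}\cup\{\infty\}$)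 of all $M$ such that there is $k\in\mathbb{N}$ with $w_k=w_{k+dn}$ for all $0\leqslant n\leqslant M-1$. *)

theory Defs
  imports
    "HOL-Algebra.Bij"
    "HOL-Algebra.Elementary_Groups"
    "HOL-Library.Stream"
    "HOL-Library.Extended_Nat"
begin

text \<open>
  The finite alphabet is a type of class \<open>finite\<close>, finite words are lists, and one-sided
  infinite words are streams, so that \<open>w !! k\<close> is the letter of \<open>w\<close> at position \<open>k\<close>
  (counting from 0).
\<close>

definition substitution :: "('a \<Rightarrow> 'a list) \<Rightarrow> bool" where
  "substitution \<rho> \<longleftrightarrow> (\<forall>a. \<rho> a \<noteq> [])"

definition subst_word :: "('a \<Rightarrow> 'a list) \<Rightarrow> 'a list \<Rightarrow> 'a list" where
  "subst_word \<rho> u = concat (map \<rho> u)"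

text \<open>Since the images of letters are nonempty, \<open>flat\<close> is concatenation of infinitely many words.\<close>

definition subst_stream :: "('a \<Rightarrow> 'a list) \<Rightarrow> 'a stream \<Rightarrow> 'a stream" where
  "subst_stream \<rho> w = flat (smap \<rho> w)"

definition subst_fixed_point :: "('a \<Rightarrow> 'a list) \<Rightarrow> 'a stream \<Rightarrow> bool" where
  "subst_fixed_point \<rho> w \<longleftrightarrow> subst_stream \<rho> w = w"

definition subst_aperiodic :: "('a \<Rightarrow> 'a list) \<Rightarrow> bool" where
  "subst_aperiodic \<rho> \<longleftrightarrow> \<not> (\<exists>v. v \<noteq> [] \<and> subst_fixed_point \<rho> (cycle v))"

definition subst_primitive :: "('a \<Rightarrow> 'a list) \<Rightarrow> bool" where
  "subst_primitive \<rho> \<longleftrightarrow> (\<exists>n\<ge>1. \<forall>a. set ((subst_word \<rho> ^^ n) [a]) = UNIV)"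

definition const_length :: "('a \<Rightarrow> 'a list) \<Rightarrow> nat \<Rightarrow> bool" where
  "const_length \<rho> L \<longleftrightarrow> (\<forall>a. length (\<rho> a) = L)"

text \<open>Meaningful only for \<open>i\<close> below the constant length of the substitution.\<close>

definition column :: "('a \<Rightarrow> 'a list) \<Rightarrow> nat \<Rightarrow> 'a \<Rightarrow> 'a" where
  "column \<rho> i a = \<rho> a ! i"

definition subst_bijective :: "('a \<Rightarrow> 'a list) \<Rightarrow> nat \<Rightarrow> bool" where
  "subst_bijective \<rho> L \<longleftrightarrow> const_length \<rho> L \<and> (\<forall>i<L. bij (column \<rho> i))"

text \<open>
  \<open>BijGroup UNIV\<close> is the symmetric group on the alphabet, with product
  \<open>f \<otimes> h = f \<circ> h\<close>.
\<close>

definition column_group :: "('a \<Rightarrow> 'a list) \<Rightarrow> nat \<Rightarrow> ('a \<Rightarrow> 'a) monoid" where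
  "column_group \<rho> L = subgroup_generated (BijGroup UNIV) (column \<rho> ` {..<L})"

definition subst_palindromic :: "('a \<Rightarrow> 'a list) \<Rightarrow> nat \<Rightarrow> ('a \<Rightarrow> 'a) \<Rightarrow> bool" where
  "subst_palindromic \<rho> L g \<longleftrightarrow>
     (\<forall>i<L. column \<rho> i \<otimes>\<^bsub>column_group \<rho> L\<^esub> column \<rho> (L - 1 - i) = g)"

text \<open>The maximal length of a monochromatic arithmetic progression of difference \<open>d\<close> in \<open>w\<close>.\<close>

definition max_mono_ap :: "'a stream \<Rightarrow> nat \<Rightarrow> enat" where
  "max_mono_ap w d = (SUP M\<in>{M. \<exists>k. \<forall>n<M. w !! k = w !! (k + d * n)}. enat M)"

text \<open>For even \<open>l\<close> the natural-number quotient \<open>(L ^ (n * l) - 1) div (L ^ n + 1)\<close> is exact.\<close>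

lemma power_plus_one_dvd_power_minus_one:
  fixes L n l :: nat
  assumes "even l"
  shows "(L ^ n + 1) dvd (L ^ (n * l) - 1)"
proof -
  obtain m where l: "l = 2 * m"
    using assms by (elim evenE)
  define x where "x = int (L ^ n)"
  have "x\<^sup>2 - 1 dvd (x\<^sup>2) ^ m - 1 ^ m"
    by (metis dvd_triv_left power_diff_sumr2)
  moreover have "x\<^sup>2 - 1 = (x + 1) * (x - 1)"
    by (simp add: power2_eq_square algebra_simps)
  ultimately have "x + 1 dvd x ^ l - 1"
    unfolding l by (metis dvd_mult_left power_mult power_one)
  then have dvd: "int (L ^ n + 1) dvd int (L ^ (n * l)) - 1"
    by (simp add: x_def power_mult add.commute)
  show ?thesis
  proof (cases "L ^ (n * l) = 0")
    case False
    then have "1 \<le> L ^ (n * l)"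
      by linarith
    then have "int (L ^ (n * l)) - 1 = int (L ^ (n * l) - 1)"
      by (metis of_nat_1 of_nat_diff)
    with dvd show ?thesis
      by (metis int_dvd_int_iff)
  next
    case True
    then show ?thesis
      by (simp only: diff_0_eq_0 dvd_0_right)
  qed
qed

end

theory Submission
  imports Defs
begin

text \<open>
  Put \<open>N = L ^ n\<close> and \<open>d = (N ^ l - 1) div (N + 1)\<close>. For \<open>1 \<le> j \<le> N\<close> the base-\<open>N\<close> expansion of
  \<open>j * d\<close> repeats the two digits \<open>j - 1\<close> and \<open>N - j\<close>, whose sum is \<open>N - 1\<close>. Palindromicity passes
  to \<open>\<rho>\<^sup>n\<close> because the columns commute, so the letter at \<open>j * d\<close> is the image of the first letter
  under a power of \<open>g\<close> that does not depend on \<open>j\<close>.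

  For finiteness, let \<open>w\<close> be constant on a long progression of some difference \<open>d > 0\<close>, and let
  \<open>L ^ e \<ge> d\<close>. For each \<open>x\<close> some \<open>i < L ^ e\<close> puts both \<open>L ^ e * x + i\<close> and \<open>L ^ e * (x + d) + i\<close>
  into the residue class of the progression, and injectivity of the \<open>i\<close>-th column of \<open>\<rho>\<^sup>e\<close> gives
  \<open>w !! x = w !! (x + d)\<close>. By primitivity every prefix of \<open>w\<close> recurs with bounded gaps, hence
  inside the range of such \<open>x\<close>; thus \<open>w\<close> would be periodic.
\<close>

section \<open>Powers of a substitution and their columns\<close>

text \<open>Given on letters, so that a power is again a substitution to which \<open>column\<close>
  and \<open>const_length\<close> apply.\<close>

definition subst_power :: "('a \<Rightarrow> 'a list) \<Rightarrow> nat \<Rightarrow> 'a \<Rightarrow> 'a list" where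
  "subst_power \<rho> p a = (subst_word \<rho> ^^ p) [a]"

lemma length_subst_word:
  assumes "const_length \<rho> L"
  shows "length (subst_word \<rho> u) = L * length u"
  using assms by (induction u) (auto simp: subst_word_def const_length_def)

lemma const_length_subst_power:
  assumes "const_length \<rho> L"
  shows "const_length (subst_power \<rho> p) (L ^ p)"
  by (induction p)
    (auto simp: const_length_def subst_power_def length_subst_word[OF assms])

lemma nth_subst_word:
  assumes "const_length \<rho> L" and "i < L" and "j < length u"
  shows "subst_word \<rho> u ! (L * j + i) = column \<rho> i (u ! j)"
  using assms(3)
proof (induction u arbitrary: j)
  case (Cons a u)
  have "length (\<rho> a) = L"
    using assms(1) by (simp add: const_length_def)
  then show ?case
    using Cons assms(2)
    by (cases j) (auto simp: subst_word_def column_def nth_append)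
qed simp

text \<open>The outermost application of \<rho> produces the lowest base-\<open>L\<close> digit of a
  position. Iterating, each column of a power is a product of columns of \<rho>, one per digit, with
  the lowest digit acting last.\<close>

lemma column_subst_power_Suc:
  assumes "const_length \<rho> L" and "i < L" and "j < L ^ p"
  shows "column (subst_power \<rho> (Suc p)) (L * j + i) a =
    column \<rho> i (column (subst_power \<rho> p) j a)"
  using nth_subst_word[OF assms(1,2), of j "subst_power \<rho> p a"] assms(3)
    const_length_subst_power[OF assms(1), of p]
  by (simp add: const_length_def column_def subst_power_def)

lemma less_power_Suc_digits:
  fixes L :: nat
  assumes "k < L ^ Suc p"
  obtains i j where "k = L * j + i" "i < L" "j < L ^ p"
proof
  have "L > 0"
    using assms by (cases L) auto
  then show "k mod L < L"
    by simp
  show "k div L < L ^ p"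
    using assms by (simp add: less_mult_imp_div_less mult.commute)
qed simp

lemma inj_column_subst_power:
  assumes "subst_bijective \<rho> L" and "k < L ^ p"
  shows "inj (column (subst_power \<rho> p) k)"
  using assms(2)
proof (induction p arbitrary: k)
  case 0
  then show ?case
    by (simp add: inj_def column_def subst_power_def)
next
  case (Suc p)
  obtain i j where k: "k = L * j + i" "i < L" "j < L ^ p"
    using Suc.prems by (rule less_power_Suc_digits)
  have "inj (column \<rho> i)"
    using assms(1) k(2) by (simp add: subst_bijective_def bij_is_inj)
  then have "inj (column \<rho> i \<circ> column (subst_power \<rho> p) j)"
    using Suc.IH[OF k(3)] by (rule inj_compose)
  moreover have "column (subst_power \<rho> (Suc p)) k = column \<rho> i \<circ> column (subst_power \<rho> p) j"
    using assms(1) k by (auto simp: subst_bijective_def column_subst_power_Suc)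
  ultimately show ?case
    by (simp only:)
qed

lemma column_subst_power_commute:
  assumes "const_length \<rho> L" and "k < L ^ p"
    and "\<And>i a. i < L \<Longrightarrow> f (column \<rho> i a) = column \<rho> i (f a)"
  shows "f (column (subst_power \<rho> p) k a) = column (subst_power \<rho> p) k (f a)"
  using assms(2)
proof (induction p arbitrary: k)
  case 0
  then show ?case
    by (simp add: column_def subst_power_def)
next
  case (Suc p)
  obtain i j where "k = L * j + i" "i < L" "j < L ^ p"
    using Suc.prems by (rule less_power_Suc_digits)
  then show ?case
    using Suc.IH assms(1,3) by (simp add: column_subst_power_Suc)
qed

text \<open>Passing from \<open>k\<close> to \<open>L ^ p - 1 - k\<close> replaces every
  base-\<open>L\<close> digit \<open>i\<close> by \<open>L - 1 - i\<close>. Commutativity brings the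
  columns of complementary digits together, and each of the \<open>p\<close> pairs contributes one
  factor \<open>g\<close>.\<close>

lemma palindromic_subst_power:
  assumes "const_length \<rho> L"
    and comm: "\<And>i j a. i < L \<Longrightarrow> j < L \<Longrightarrow>
      column \<rho> i (column \<rho> j a) = column \<rho> j (column \<rho> i a)"
    and pal: "\<And>i a. i < L \<Longrightarrow> column \<rho> i (column \<rho> (L - 1 - i) a) = g a"
    and "k < L ^ p"
  shows "column (subst_power \<rho> p) k (column (subst_power \<rho> p) (L ^ p - 1 - k) a) = (g ^^ p) a"
  using assms(4)
proof (induction p arbitrary: k)
  case 0
  then show ?case
    by (simp add: column_def subst_power_def)
next
  case (Suc p)
  obtain i j where k: "k = L * j + i" and i: "i < L" and j: "j < L ^ p"
    using Suc.prems by (rule less_power_Suc_digits)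
  define i' j' where "i' = L - 1 - i" and "j' = L ^ p - 1 - j"
  have i': "i' < L" and j': "j' < L ^ p"
    using i j by (auto simp: i'_def j'_def)
  have "i + i' + 1 = L" and "j + j' + 1 = L ^ p"
    using i j by (auto simp: i'_def j'_def)
  then have "L ^ Suc p = L * (j + j') + L"
    by (metis add_mult_distrib2 mult_1_right power_Suc)
  with \<open>i + i' + 1 = L\<close> have k': "L ^ Suc p - 1 - k = L * j' + i'"
    by (simp add: k algebra_simps)
  have "column (subst_power \<rho> (Suc p)) k (column (subst_power \<rho> (Suc p)) (L ^ Suc p - 1 - k) a) =
      column \<rho> i (column (subst_power \<rho> p) j (column \<rho> i' (column (subst_power \<rho> p) j' a)))"
    unfolding k' unfolding k by (simp only: column_subst_power_Suc[OF assms(1)] i i' j j')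
  also have "\<dots> = column \<rho> i (column \<rho> i' (column (subst_power \<rho> p) j
      (column (subst_power \<rho> p) j' a)))"
    using column_subst_power_commute[OF assms(1) j, of "column \<rho> i'"] comm i' by simp
  also have "\<dots> = (g ^^ Suc p) a"
    using pal[OF i] Suc.IH[OF j] by (simp add: i'_def j'_def)
  finally show ?case .
qed

section \<open>Letters of fixed points, and periodic streams\<close>

lemma snth_subst_stream:
  assumes "const_length \<rho> L" and "i < L"
  shows "subst_stream \<rho> w !! (L * q + i) = column \<rho> i (w !! q)"
proof (induction q arbitrary: w)
  case 0
  have "length (\<rho> (shd w)) = L" and "\<rho> (shd w) \<noteq> []"
    using assms by (simp_all add: const_length_def flip: length_greater_0_conv)
  then show ?case
    using assms(2) by (simp add: subst_stream_def flat_unfold column_def)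
next
  case (Suc q)
  have "length (\<rho> (shd w)) = L" and "\<rho> (shd w) \<noteq> []"
    using assms by (simp_all add: const_length_def flip: length_greater_0_conv)
  then show ?case
    using Suc[of "stl w"] by (simp add: subst_stream_def flat_unfold algebra_simps)
qed

lemma snth_fixed_point:
  assumes "const_length \<rho> L" and "subst_fixed_point \<rho> w" and "k < L ^ p"
  shows "w !! (L ^ p * q + k) = column (subst_power \<rho> p) k (w !! q)"
  using assms(3)
proof (induction p arbitrary: k)
  case 0
  then show ?case
    by (simp add: column_def subst_power_def)
next
  case (Suc p)
  obtain i j where k: "k = L * j + i" "i < L" "j < L ^ p"
    using Suc.prems by (rule less_power_Suc_digits)
  have "w !! (L ^ Suc p * q + k) = subst_stream \<rho> w !! (L * (L ^ p * q + j) + i)"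
    using assms(2) by (simp add: k subst_fixed_point_def algebra_simps)
  also have "\<dots> = column \<rho> i (column (subst_power \<rho> p) j (w !! q))"
    using snth_subst_stream[OF assms(1) k(2)] Suc.IH[OF k(3)] by simp
  finally show ?case
    using column_subst_power_Suc[OF assms(1) k(2,3)] by (simp add: k)
qed

lemma stream_eq_snthI:
  assumes "\<And>i. u !! i = v !! i"
  shows "u = v"
  using assms smap_alt[of id u v] by (simp add: stream.map_id)

lemma shift_eq_imp_eq_cycle:
  assumes "u \<noteq> []" and w: "w = u @- w"
  shows "w = cycle u"
proof (rule stream_eq_snthI)
  show "w !! i = cycle u !! i" for i
  proof (induction i rule: less_induct)
    case (less i)
    have *: "w !! i = (u @- w) !! i" "cycle u !! i = (u @- cycle u) !! i"
      by (rule w[THEN arg_cong] cycle_decomp[OF assms(1), THEN arg_cong])+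
    show ?case
    proof (cases "i < length u")
      case False
      moreover have "length u > 0"
        using assms(1) by simp
      ultimately have "i - length u < i"
        by linarith
      then show ?thesis
        using less False unfolding * by simp
    qed (simp add: *)
  qed
qed

lemma periodic_stream_eq_cycle:
  assumes "d > 0" and "\<And>r. w !! (r + d) = w !! r"
  shows "w = cycle (stake d w)"
proof -
  have "sdrop d w !! r = w !! r" for r
    using assms(2)[of r] by (simp add: sdrop_snth add.commute)
  then have "sdrop d w = w"
    by (rule stream_eq_snthI)
  then have "w = stake d w @- w"
    by (metis stake_sdrop)
  then show ?thesis
    using assms(1) by (intro shift_eq_imp_eq_cycle) auto
qed

section \<open>Finiteness of the progressions\<close>

text \<open>For \<open>L = 1\<close> the substitution would be the identity, which fixes every
  constant stream.\<close>

lemma aperiodic_imp_length_ge_2: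
  assumes "substitution \<rho>" and "subst_aperiodic \<rho>" and "const_length \<rho> L"
    and "column \<rho> 0 = id"
  shows "L \<ge> 2"
proof (rule ccontr)
  assume "\<not> L \<ge> 2"
  moreover have "L \<noteq> 0"
    using assms(1,3) by (auto simp: substitution_def const_length_def)
  ultimately have "L = 1"
    by simp
  then have "subst_stream \<rho> u !! q = u !! q" for u q
    using snth_subst_stream[OF assms(3), of 0 u q] assms(4) by simp
  then have "subst_fixed_point \<rho> (cycle [undefined])"
    unfolding subst_fixed_point_def by (intro stream_eq_snthI)
  then show False
    using assms(2) unfolding subst_aperiodic_def by blast
qed

text \<open>The positions compared differ by \<open>L ^ e * d\<close>, a multiple of
  \<open>d\<close>, so if one is on the progression then both have its residue. The bounds
  \<open>lower\<close> and \<open>upper\<close> keep both within its range.\<close>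

lemma mono_ap_imp_eq:
  fixes w :: "'a stream"
  assumes "subst_bijective \<rho> L" and "subst_fixed_point \<rho> w" and "d > 0" and "d \<le> L ^ e"
    and ap: "\<forall>n<M. w !! k = w !! (k + d * n)"
    and lower: "k \<le> L ^ e * x" and upper: "L ^ e * (x + d + 1) \<le> k + d * M"
  shows "w !! x = w !! (x + d)"
proof -
  have len: "const_length \<rho> L"
    using assms(1) by (simp add: subst_bijective_def)
  obtain i t where i: "i < d" and t: "L ^ e * x + i = k + d * t"
  proof -
    define y where "y = L ^ e * x - k"
    \<comment> \<open>\<open>t\<close> is \<open>y / d\<close> rounded up, so \<open>d * t\<close>
      overshoots \<open>y\<close> by less than \<open>d\<close>; the overshoot is the witness for
      \<open>i\<close>.\<close>
    define t where "t = (y + (d - 1)) div d"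
    have "(y + (d - 1)) mod d < d"
      using assms(3) by simp
    moreover have "y + (d - 1) = d * t + (y + (d - 1)) mod d"
      by (simp add: t_def)
    ultimately have "d * t - y < d" and "y + (d * t - y) = d * t"
      using assms(3) by linarith+
    then show thesis
      using that[of "d * t - y" t] lower by (simp add: y_def)
  qed
  have iL: "i < L ^ e"
    using i assms(4) by simp
  have t': "L ^ e * (x + d) + i = k + d * (t + L ^ e)"
    using t by (simp add: algebra_simps)
  have "L ^ e * (x + d) + i < k + d * M"
    using upper iL by (simp add: algebra_simps)
  then have "t + L ^ e < M"
    by (simp add: t')
  then have "w !! (L ^ e * x + i) = w !! (L ^ e * (x + d) + i)"
    unfolding t t' using ap[rule_format, of t] ap[rule_format, of "t + L ^ e"] by simp
  then show ?thesis
    using inj_column_subst_power[OF assms(1) iL]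
    by (simp add: snth_fixed_point[OF len assms(2) iL] inj_eq)
qed

text \<open>By primitivity \<open>w !! 0\<close> occurs in the \<open>p\<close>-th power image of
  every letter, and the \<open>m\<close>-th power turns each such occurrence into a copy of the
  prefix of length \<open>L ^ m\<close>. The same \<open>p\<close> serves all
  \<open>m\<close>.\<close>

lemma prefix_recurs:
  assumes "subst_primitive \<rho>" and "const_length \<rho> L" and "subst_fixed_point \<rho> w"
  obtains p where "\<And>m q. \<exists>s<L ^ p. \<forall>r<L ^ m. w !! (L ^ m * (L ^ p * q + s) + r) = w !! r"
proof -
  obtain p where p: "\<And>a. set (subst_power \<rho> p a) = UNIV"
    using assms(1) by (auto simp: subst_primitive_def subst_power_def)
  have "\<exists>s<L ^ p. \<forall>r<L ^ m. w !! (L ^ m * (L ^ p * q + s) + r) = w !! r" for m q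
  proof -
    have "w !! 0 \<in> set (subst_power \<rho> p (w !! q))"
      using p by simp
    then obtain s where s: "s < L ^ p" and "column (subst_power \<rho> p) s (w !! q) = w !! 0"
      using const_length_subst_power[OF assms(2), of p]
      unfolding in_set_conv_nth const_length_def column_def by auto
    then have *: "w !! (L ^ p * q + s) = w !! 0"
      by (simp only: snth_fixed_point[OF assms(2,3)])
    have "w !! (L ^ m * (L ^ p * q + s) + r) = w !! r" if "r < L ^ m" for r
      using snth_fixed_point[OF assms(2,3) that, of 0]
        snth_fixed_point[OF assms(2,3) that, of "L ^ p * q + s"] by (simp add: *)
    with s show ?thesis
      by blast
  qed
  then show thesis
    by (rule that)
qed

lemma max_mono_ap_finite:
  fixes w :: "'a stream"
  assumes "subst_aperiodic \<rho>" and "subst_primitive \<rho>" and "subst_bijective \<rho> L"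
    and "subst_fixed_point \<rho> w" and "L \<ge> 2" and "d > 0"
  shows "max_mono_ap w d < \<infinity>"
proof (rule ccontr)
  assume unbounded: "\<not> max_mono_ap w d < \<infinity>"
  have len: "const_length \<rho> L"
    using assms(3) by (simp add: subst_bijective_def)
  have large: "\<exists>m. y < L ^ m" for y
    using assms(5) power_gt_expt[of L y] by auto
  have ap: "\<exists>k. \<forall>n<M. w !! k = w !! (k + d * n)" for M
  proof (rule ccontr)
    assume *: "\<nexists>k. \<forall>n<M. w !! k = w !! (k + d * n)"
    \<comment> \<open>The admissible lengths are closed downwards, so a length that fails bounds all
      of them.\<close>
    have "M' < M" if "\<exists>k. \<forall>n<M'. w !! k = w !! (k + d * n)" for M'
    proof (rule ccontr)
      assume "\<not> M' < M"
      then have "\<exists>k. \<forall>n<M. w !! k = w !! (k + d * n)"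
        using that by (meson not_less order_less_le_trans)
      with * show False ..
    qed
    then have "max_mono_ap w d \<le> enat M"
      unfolding max_mono_ap_def by (intro SUP_least) (auto intro: less_imp_le)
    also have "enat M < \<infinity>"
      by simp
    finally show False
      using unbounded by contradiction
  qed
  obtain p where p: "\<And>m q. \<exists>s<L ^ p. \<forall>r<L ^ m. w !! (L ^ m * (L ^ p * q + s) + r) = w !! r"
    using prefix_recurs[OF assms(2) len assms(4)] by blast
  have "w !! (r + d) = w !! r" for r
  proof -
    obtain m e where m: "r + d < L ^ m" and e: "d < L ^ e"
      using large by blast
    \<comment> \<open>A window of \<open>L ^ m * L ^ p\<close> letters contains a copy of the
      prefix; \<open>Q\<close> is the length of its image under the \<open>e\<close>-th power. The
      first multiple of \<open>Q\<close> beyond \<open>k\<close> starts a block of length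
      \<open>Q\<close> that ends by \<open>k + 2 * Q\<close>, hence the choice of
      \<open>2 * Q\<close> terms.\<close>
    define Q where "Q = L ^ e * (L ^ m * L ^ p)"
    obtain k where k: "\<forall>n<2 * Q. w !! k = w !! (k + d * n)"
      using ap by metis
    define q where "q = k div Q + 1"
    have "Q > 0"
      using assms(5) by (simp add: Q_def)
    then have q: "k \<le> Q * q" "Q * q \<le> k + Q"
      using dividend_less_times_div[of Q k] by (simp_all add: q_def algebra_simps)
    obtain s where s: "s < L ^ p"
      and rec: "\<forall>r<L ^ m. w !! (L ^ m * (L ^ p * q + s) + r) = w !! r"
      using p by metis
    \<comment> \<open>As \<open>r + d < L ^ m\<close>, both \<open>x\<close> and
      \<open>x + d\<close> lie in the copy of the prefix that starts at
      \<open>x - r\<close>.\<close>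
    define x where "x = L ^ m * (L ^ p * q + s) + r"
    have "Q * q \<le> L ^ e * x"
      by (simp add: Q_def x_def algebra_simps)
    then have lower: "k \<le> L ^ e * x"
      using q by simp
    have "x + d + 1 \<le> L ^ m * (L ^ p * q + (s + 1))"
      using m by (simp add: x_def algebra_simps)
    also have "\<dots> \<le> L ^ m * (L ^ p * q + L ^ p)"
      using s by (intro mult_le_mono add_left_mono) auto
    finally have "L ^ e * (x + d + 1) \<le> L ^ e * (L ^ m * (L ^ p * q + L ^ p))"
      by (rule mult_le_mono2)
    also have "\<dots> = Q * q + Q"
      by (simp add: Q_def algebra_simps)
    also have "\<dots> \<le> k + 2 * Q"
      using q by simp
    also have "\<dots> \<le> k + d * (2 * Q)"
      using assms(6) by simp
    finally have "w !! x = w !! (x + d)"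
      using mono_ap_imp_eq[OF assms(3,4,6) _ k lower] e by simp
    moreover have "w !! x = w !! r" and "w !! (x + d) = w !! (r + d)"
      using rec m by (auto simp: x_def add.assoc)
    ultimately show ?thesis
      by simp
  qed
  then have "w = cycle (stake d w)"
    by (rule periodic_stream_eq_cycle[OF assms(6)])
  moreover have "stake d w \<noteq> []"
    using assms(6) by (metis length_stake list.size(3) less_numeral_extra(3))
  ultimately show False
    using assms(1,4) unfolding subst_aperiodic_def by metis
qed

section \<open>The lower bound from palindromicity\<close>

text \<open>The sum is the expansion of the common difference in base \<open>N\<^sup>2\<close>.\<close>

lemma power_minus_one_div_plus_one:
  fixes N :: nat
  assumes "N > 0"
  shows "(N ^ (2 * t) - 1) div (N + 1) = (\<Sum>i<t. (N\<^sup>2) ^ i * (N - 1))"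
proof -
  obtain M where N: "N = Suc M"
    using assms by (cases N) auto
  have "(N + 1) * (\<Sum>i<t. (N\<^sup>2) ^ i * (N - 1)) + 1 = N ^ (2 * t)"
  proof (induction t)
    case (Suc t)
    have "(N + 1) * (\<Sum>i<Suc t. (N\<^sup>2) ^ i * (N - 1)) + 1 =
        N ^ (2 * t) + (N\<^sup>2) ^ t * ((N + 1) * (N - 1))"
      unfolding Suc[symmetric] by (simp add: algebra_simps)
    also have "\<dots> = (N\<^sup>2) ^ t * ((N + 1) * (N - 1) + 1)"
      by (simp only: power_mult distrib_left mult_1_right add.commute)
    also have "(N + 1) * (N - 1) + 1 = N\<^sup>2"
      by (simp add: N power2_eq_square)
    finally show ?case
      by (simp only: power_mult power_Suc mult.commute[of "N\<^sup>2"])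
  qed simp
  then have "N ^ (2 * t) - 1 = (N + 1) * (\<Sum>i<t. (N\<^sup>2) ^ i * (N - 1))"
    by linarith
  then show ?thesis
    by (simp only: nonzero_mult_div_cancel_left)
qed

text \<open>Each induction step splits off two base-\<open>N\<close> digits, since
  \<open>Suc j * (N - 1) = N * j + (N - 1 - j)\<close>. The columns at these complementary digits
  compose to \<open>g ^^ n\<close>, whatever \<open>j\<close> is.\<close>

lemma palindromic_snth:
  fixes L n :: nat
  defines "N \<equiv> L ^ n"
  assumes "const_length \<rho> L" and "subst_fixed_point \<rho> w"
    and "\<And>i j a. i < L \<Longrightarrow> j < L \<Longrightarrow>
      column \<rho> i (column \<rho> j a) = column \<rho> j (column \<rho> i a)"
    and "\<And>i a. i < L \<Longrightarrow> column \<rho> i (column \<rho> (L - 1 - i) a) = g a"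
    and "j < N"
  shows "w !! (Suc j * (\<Sum>i<t. (N\<^sup>2) ^ i * (N - 1))) = ((g ^^ n) ^^ t) (w !! 0)"
proof (induction t)
  case (Suc t)
  define S where "S = (\<Sum>i<t. (N\<^sup>2) ^ i * (N - 1))"
  obtain j' where N: "N = j + j' + 1"
    using assms(6) by (metis less_natE add_Suc_right Suc_eq_plus1)
  then have j': "j' = N - 1 - j" "j' < N" and j: "N - 1 - j' = j"
    by simp_all
  \<comment> \<open>The term \<open>i = 0\<close> is separated, because the lowest pair of digits
    selects the outermost columns.\<close>
  have "(\<Sum>i<Suc t. (N\<^sup>2) ^ i * (N - 1)) = N\<^sup>2 * S + (N - 1)"
    by (simp add: sum.lessThan_Suc_shift S_def sum_distrib_left mult.assoc del: sum.lessThan_Suc)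
  then have "Suc j * (\<Sum>i<Suc t. (N\<^sup>2) ^ i * (N - 1)) = Suc j * (N\<^sup>2 * S + (N - 1))"
    by (rule arg_cong)
  also have "\<dots> = N * (N * (Suc j * S) + j) + j'"
  proof -
    have "Suc j * (N - 1) = N * j + j'"
      by (simp add: N algebra_simps)
    then show ?thesis
      by (simp only: distrib_left power2_eq_square mult.assoc mult.left_commute add.assoc)
  qed
  finally have "w !! (Suc j * (\<Sum>i<Suc t. (N\<^sup>2) ^ i * (N - 1))) =
      column (subst_power \<rho> n) j' (column (subst_power \<rho> n) j (w !! (Suc j * S)))"
    using snth_fixed_point[OF assms(2,3)] j'(2) assms(6) by (simp add: N_def)
  also have "\<dots> = (g ^^ n) (w !! (Suc j * S))"
    using palindromic_subst_power[OF assms(2,4,5), of j' n "w !! (Suc j * S)"] j'(2) j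
    by (simp add: N_def)
  finally show ?case
    using Suc.IH by (simp add: S_def)
qed simp

section \<open>The column group and the conclusion\<close>

text \<open>Multiplication in \<open>BijGroup\<close> is a function restricted to bijections, so it
  is composition only under these hypotheses.\<close>

lemma mult_column_group:
  assumes "bij f" and "bij h"
  shows "f \<otimes>\<^bsub>column_group \<rho> L\<^esub> h = f \<circ> h"
  using assms
  by (simp add: column_group_def BijGroup_def Bij_def compose_def fun_eq_iff)

lemma column_in_column_group:
  assumes "subst_bijective \<rho> L" and "i < L"
  shows "column \<rho> i \<in> carrier (column_group \<rho> L)"
  using assms unfolding column_group_def carrier_subgroup_generated
  by (intro generate.incl) (auto simp: subst_bijective_def BijGroup_def Bij_def)

theorem proposition12:
  fixes \<rho> :: "'a::finite \<Rightarrow> 'a list" and L :: nat and w :: "'a stream" and n l :: nat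
  assumes "substitution \<rho>"
    and "subst_aperiodic \<rho>"
    and "subst_primitive \<rho>"
    and "const_length \<rho> L"
    and "subst_bijective \<rho> L"
    and "column \<rho> 0 = id"
    and "comm_group (column_group \<rho> L)"
    and "\<exists>g \<in> carrier (column_group \<rho> L). subst_palindromic \<rho> L g"
    and "subst_fixed_point \<rho> w"
    and "n \<ge> 1"
    and "l \<ge> 2" and "even l"
  shows "enat (L ^ n) \<le> max_mono_ap w ((L ^ (n * l) - 1) div (L ^ n + 1))
       \<and> max_mono_ap w ((L ^ (n * l) - 1) div (L ^ n + 1)) < \<infinity>"
proof -
  have L: "L \<ge> 2"
    using aperiodic_imp_length_ge_2 assms(1,2,4,6) by blast
  have bij: "bij (column \<rho> i)" if "i < L" for i
    using assms(5) that by (simp add: subst_bijective_def)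
  have comm: "column \<rho> i (column \<rho> j a) = column \<rho> j (column \<rho> i a)" if "i < L" "j < L" for i j a
  proof -
    interpret comm_group "column_group \<rho> L"
      by (fact assms(7))
    show ?thesis
      using m_comm[OF column_in_column_group[OF assms(5) that(1)]
          column_in_column_group[OF assms(5) that(2)]] that
      by (simp add: mult_column_group bij fun_eq_iff)
  qed
  obtain g where "subst_palindromic \<rho> L g"
    using assms(8) by blast
  then have pal: "column \<rho> i (column \<rho> (L - 1 - i) a) = g a" if "i < L" for i a
    using that unfolding subst_palindromic_def
    by (auto simp: mult_column_group bij fun_eq_iff)
  define N where "N = L ^ n"
  have "L ^ 1 \<le> N"
    unfolding N_def using L assms(10) by (intro power_increasing) auto
  then have N: "N \<ge> 2"
    using L by simp
  obtain t where l: "l = 2 * t"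
    using assms(12) by blast
  define d where "d = (\<Sum>i<t. (N\<^sup>2) ^ i * (N - 1))"
  have d: "(L ^ (n * l) - 1) div (L ^ n + 1) = d"
    using power_minus_one_div_plus_one[of N t] N
    by (simp only: d_def l N_def power_mult)
  \<comment> \<open>From \<open>l \<ge> 2\<close> follows \<open>t \<ge> 1\<close>, so the sum is
    not empty.\<close>
  have "d > 0"
    unfolding d_def using N assms(11) l by (intro sum_pos) (auto simp: lessThan_empty_iff)
  then have "max_mono_ap w d < \<infinity>"
    using max_mono_ap_finite assms(2,3,5,9) L by blast
  \<comment> \<open>The progression starts at \<open>d\<close>, not at 0: its positions are the
    multiples \<open>Suc j * d\<close> with \<open>j < N\<close>, on which the letter is
    constant.\<close>
  moreover have "w !! d = w !! (d + d * j)" if "j < N" for j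
    using palindromic_snth[OF assms(4,9) comm pal, of j n t] that
      palindromic_snth[OF assms(4,9) comm pal, of 0 n t] N
    by (simp add: d_def mult.commute flip: N_def)
  then have "enat N \<le> max_mono_ap w d"
    unfolding max_mono_ap_def by (intro SUP_upper) blast
  ultimately show ?thesis
    unfolding d by (simp add: N_def)
qed

end
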